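(* The Peláez–Lamata index $PLI$ does not satisfy the upper boundary axiom: it is not true that for every order $n\ge3$ there exists $K\in\mathbb{R}$ with $PLI(A)\le K$ for all reciprocal matrices $A\in M_R$ of order $n$. That is, there is an order $n\ge 3$ for which $PLI$ is not bounded from above on $M_R$.
   Context: $M_R$ is the set of all real $n\times n$ matrices $A=(a_{ij})$ with $a_{ij}>0$ for all $i,j$ and $a_{ij}=1/a_{ji}$ for all $i,j$ (reciprocal matrices). For $n\ge3$ and $A\in M_R$, $$PLI(A)=\frac{6}{n(n-1)(n-2)}\sum_{i=1}^{n-2}\sum_{j=i+1}^{n-1}\sum_{k=j+1}^{n}\left(\frac{a_{ik}}{a_{ij}a_{jk}}+\frac{a_{ij}a_{jk}}{a_{ik}}-2\right).$$ *)

theory Defs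
  imports Complex_Main "Jordan_Normal_Form.Matrix"
begin

definition reciprocal_matrices :: "nat \<Rightarrow> real mat set" where
  "reciprocal_matrices n =
     {A \<in> carrier_mat n n.
        (\<forall>i<n. \<forall>j<n. A $$ (i, j) > 0) \<and>
        (\<forall>i<n. \<forall>j<n. A $$ (i, j) = 1 / A $$ (j, i))}"

text \<open>
  Matrix indices start at 0 in the library, so the ranges \<open>1 \<le> i \<le> n - 2\<close>,
  \<open>i + 1 \<le> j \<le> n - 1\<close>, \<open>j + 1 \<le> k \<le> n\<close> are shifted down by one.
  The index is only meaningful for square matrices of order at least 3.
\<close>

definition PLI :: "real mat \<Rightarrow> real" where
  "PLI A = (let n = dim_row A in
     6 / (real n * (real n - 1) * (real n - 2)) *
     (\<Sum>i = 0..<n - 2. \<Sum>j = i + 1..<n - 1. \<Sum>k = j + 1..<n.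
        A $$ (i, k) / (A $$ (i, j) * A $$ (j, k)) +
        A $$ (i, j) * A $$ (j, k) / A $$ (i, k) - 2))"

text \<open>The bound \<open>K\<close> may depend on the order \<open>n\<close>.\<close>

definition upper_boundary_axiom :: "(real mat \<Rightarrow> real) \<Rightarrow> bool" where
  "upper_boundary_axiom I \<longleftrightarrow>
     (\<forall>n\<ge>3. \<exists>K::real. \<forall>A\<in>reciprocal_matrices n. I A \<le> K)"

end

theory Submission
  imports Defs
begin

text \<open>Order 3 already fails. A reciprocal matrix of order 3 has a single triple to test for
  consistency, and its corner entry can be any \<open>x > 0\<close> while the other two entries
  above the diagonal stay 1. The index is then \<open>x + 1 / x - 2\<close>, which is unbounded in
  \<open>x\<close>.\<close>

definition corner_matrix :: "real \<Rightarrow> real mat" where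
  "corner_matrix x = mat 3 3 (\<lambda>(i, j).
     if i = 0 \<and> j = 2 then x else if i = 2 \<and> j = 0 then 1 / x else 1)"

lemma corner_matrix_reciprocal:
  assumes "x > 0"
  shows "corner_matrix x \<in> reciprocal_matrices 3"
  using assms by (auto simp: corner_matrix_def reciprocal_matrices_def)

text \<open>For \<open>n = 3\<close> the prefactor is 6/(3*2*1) = 1 and the triple sum has the
  single term (0, 1, 2).\<close>

lemma PLI_corner_matrix: "PLI (corner_matrix x) = x + 1 / x - 2"
proof -
  have "{0..<3 - 2} = {0::nat}" "{0 + 1..<3 - 1} = {1::nat}" "{1 + 1..<3} = {2::nat}"
    by auto
  then show ?thesis
    by (simp add: PLI_def Let_def corner_matrix_def)
qed

theorem proposition20: "\<not> upper_boundary_axiom PLI"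
proof
  assume "upper_boundary_axiom PLI"
  then obtain K where K: "\<And>A. A \<in> reciprocal_matrices 3 \<Longrightarrow> PLI A \<le> K"
    unfolding upper_boundary_axiom_def by blast
  \<comment> \<open>The 2 cancels the \<open>- 2\<close> in the index, leaving
    \<open>\<bar>K\<bar> + 1 / x\<close>, which exceeds \<open>K\<close>; it also makes
    \<open>x\<close> positive.\<close>
  define x where "x = \<bar>K\<bar> + 2"
  have "x > 0"
    by (simp add: x_def)
  then have "x + 1 / x - 2 \<le> K"
    using K corner_matrix_reciprocal PLI_corner_matrix by metis
  moreover have "1 / x > 0"
    using \<open>x > 0\<close> by simp
  ultimately show False
    unfolding x_def by linarith
qed

end
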